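(* Let $w,u$ be step sequences over a comtrace alphabet $\Theta=(\Sigma,\mathit{sim},\mathit{ser})$. Then $w\equiv_\Theta u$ if and only if $\Pi^\perp_{a,b}(w)=\Pi^\perp_{a,b}(u)$ for all $(a,b)\in(\Sigma\times\Sigma)\setminus\mathit{ind}$.
   Context: A comtrace alphabet is $\Theta=(\Sigma,\mathit{sim},\mathit{ser})$ with $\Sigma$ finite nonempty, $\mathit{ser}\subseteq\mathit{sim}\subseteq\Sigma\times\Sigma$, $\mathit{sim}$ irreflexive and symmetric. Steps: nonempty $A\subseteq\Sigma$ with $(a,b)\in\mathit{sim}$ for distinct $a,b\in A$. $\equiv_\Theta$ is the reflexive, symmetric, transitive closure of $uABz\sim_\Theta u(A\cup B)z$ for steps $A,B$ with $A\times B\subseteq\mathit{ser}$. Derived relations: $\mathit{ind}=\mathit{ser}\cap\mathit{ser}^{-1}$, $\mathit{ssm}=\mathit{sim}\setminus(\mathit{ser}\cup\mathit{ser}^{-1})$, $\mathit{wdp}=\mathit{ser}^{-1}\setminus\mathit{ser}$. Let $\perp\notin\Sigma$ be a new symbol. For $(a,b)\notin\mathit{ind}$ (possibly $a=b$) and a step $A$, define $\Pi^\perp_{a,b}(A)\in(\Sigma\cup\{\perp\})^*$ by: $\epsilon$ if $\{a,b\}\cap A=\emptyset$; $a$ if $a\in A$, $b\notin A$; $b$ if $b\in A$, $a\notin A$; $a$ if $a=b\in A$; and for $a\neq b$ both in $A$: $ba$ if $(a,b)\in\mathit{wdp}$, $ab$ if $(b,a)\in\mathit{wdp}$, $\perp$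 if $(a,b)\in\mathit{ssm}$. For a step sequence $A_1\ldots A_n$, $\Pi^\perp_{a,b}(A_1\ldots A_n)=\Pi^\perp_{a,b}(A_1)\cdots\Pi^\perp_{a,b}(A_n)$. *)

theory Defs
  imports Main
begin

definition comtrace_alphabet :: "'a set \<Rightarrow> ('a \<times> 'a) set \<Rightarrow> ('a \<times> 'a) set \<Rightarrow> bool" where
  "comtrace_alphabet \<Sigma> sim ser \<longleftrightarrow>
     finite \<Sigma> \<and> \<Sigma> \<noteq> {} \<and> ser \<subseteq> sim \<and> sim \<subseteq> \<Sigma> \<times> \<Sigma> \<and> irrefl sim \<and> sym sim"

definition is_step :: "'a set \<Rightarrow> ('a \<times> 'a) set \<Rightarrow> 'a set \<Rightarrow> bool" where
  "is_step \<Sigma> sim A \<longleftrightarrow>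
     A \<noteq> {} \<and> A \<subseteq> \<Sigma> \<and> (\<forall>a\<in>A. \<forall>b\<in>A. a \<noteq> b \<longrightarrow> (a, b) \<in> sim)"

definition is_step_seq :: "'a set \<Rightarrow> ('a \<times> 'a) set \<Rightarrow> 'a set list \<Rightarrow> bool" where
  "is_step_seq \<Sigma> sim w \<longleftrightarrow> (\<forall>A\<in>set w. is_step \<Sigma> sim A)"

definition comtrace_rewr ::
  "'a set \<Rightarrow> ('a \<times> 'a) set \<Rightarrow> ('a \<times> 'a) set \<Rightarrow> 'a set list \<Rightarrow> 'a set list \<Rightarrow> bool" where
  "comtrace_rewr \<Sigma> sim ser w v \<longleftrightarrow>
     (\<exists>x z A B. is_step_seq \<Sigma> sim x \<and> is_step_seq \<Sigma> sim z \<and>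
        is_step \<Sigma> sim A \<and> is_step \<Sigma> sim B \<and> A \<times> B \<subseteq> ser \<and>
        w = x @ [A, B] @ z \<and> v = x @ [A \<union> B] @ z)"

definition comtrace_equiv ::
  "'a set \<Rightarrow> ('a \<times> 'a) set \<Rightarrow> ('a \<times> 'a) set \<Rightarrow> 'a set list \<Rightarrow> 'a set list \<Rightarrow> bool" where
  "comtrace_equiv \<Sigma> sim ser = equivclp (comtrace_rewr \<Sigma> sim ser)"

definition ind :: "('a \<times> 'a) set \<Rightarrow> ('a \<times> 'a) set" where
  "ind ser = ser \<inter> ser\<inverse>"

definition ssm :: "('a \<times> 'a) set \<Rightarrow> ('a \<times> 'a) set \<Rightarrow> ('a \<times> 'a) set" where
  "ssm sim ser = sim - (ser \<union> ser\<inverse>)"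

definition wdp :: "('a \<times> 'a) set \<Rightarrow> ('a \<times> 'a) set" where
  "wdp ser = ser\<inverse> - ser"

text \<open>Words over \<open>\<Sigma> \<union> {\<bottom>}\<close> are lists over the option type, with \<^term>\<open>None\<close> for the
  new symbol \<open>\<bottom>\<close>. The projection is meant only for \<open>(a, b) \<notin> ind\<close> and steps \<open>A\<close>; the
  final branch is unreachable there (lemma \<open>pair_in_step_cases\<close>).\<close>

definition proj_step ::
  "('a \<times> 'a) set \<Rightarrow> ('a \<times> 'a) set \<Rightarrow> 'a \<Rightarrow> 'a \<Rightarrow> 'a set \<Rightarrow> 'a option list" where
  "proj_step sim ser a b A =
     (if a \<notin> A \<and> b \<notin> A then []
      else if a \<in> A \<and> b \<notin> A then [Some a]
      else if b \<in> A \<and> a \<notin> A then [Some b]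
      else if a = b then [Some a]
      else if (a, b) \<in> wdp ser then [Some b, Some a]
      else if (b, a) \<in> wdp ser then [Some a, Some b]
      else if (a, b) \<in> ssm sim ser then [None]
      else undefined)"

lemma pair_in_step_cases:
  assumes "is_step \<Sigma> sim A" and "a \<in> A" and "b \<in> A" and "a \<noteq> b" and "(a, b) \<notin> ind ser"
  shows "(a, b) \<in> wdp ser \<or> (b, a) \<in> wdp ser \<or> (a, b) \<in> ssm sim ser"
  using assms by (auto simp: is_step_def ind_def wdp_def ssm_def)

definition proj ::
  "('a \<times> 'a) set \<Rightarrow> ('a \<times> 'a) set \<Rightarrow> 'a \<Rightarrow> 'a \<Rightarrow> 'a set list \<Rightarrow> 'a option list" where
  "proj sim ser a b w = concat (map (proj_step sim ser a b) w)"

end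

theory Submission
  imports Defs
begin

text \<open>Projections are invariant under the rewriting, and they cancel on the left. Conversely, if
  \<open>w = A # w'\<close> and \<open>u\<close> have equal projections, let \<open>C\<close> be a minimal nonempty subset of \<open>A\<close> that
  can be split off to the left, i.e. \<open>C \<times> (A - C) \<subseteq> ser\<close>. Minimality forces the
  first occurrences in \<open>u\<close> of all elements of \<open>C\<close> into one step, from which \<open>C\<close> can be split off to
  the left, and everything before that step is independent of \<open>C\<close>. So both \<open>w\<close> and \<open>u\<close> are
  equivalent to sequences starting with \<open>C\<close>, and induction on the number of events applies to what
  follows.\<close>

locale comtrace =
  fixes \<Sigma> :: "'a set" and sim ser :: "('a \<times> 'a) set"
  assumes alphabet: "comtrace_alphabet \<Sigma> sim ser"
begin

abbreviation step :: "'a set \<Rightarrow> bool" where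
  "step \<equiv> is_step \<Sigma> sim"

abbreviation step_seq :: "'a set list \<Rightarrow> bool" where
  "step_seq \<equiv> is_step_seq \<Sigma> sim"

abbreviation equivalent :: "'a set list \<Rightarrow> 'a set list \<Rightarrow> bool" (infix "\<approx>" 50) where
  "w \<approx> u \<equiv> comtrace_equiv \<Sigma> sim ser w u"

abbreviation same_proj :: "'a set list \<Rightarrow> 'a set list \<Rightarrow> bool" where
  "same_proj w u \<equiv> \<forall>(a, b) \<in> (\<Sigma> \<times> \<Sigma>) - ind ser. proj sim ser a b w = proj sim ser a b u"

lemma ser_irrefl: "(a, a) \<notin> ser"
  using alphabet by (auto simp: comtrace_alphabet_def irrefl_def)

lemma step_finite: "step A \<Longrightarrow> finite A"
  using alphabet by (auto simp: comtrace_alphabet_def is_step_def intro: finite_subset)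

lemma step_subset: "step A \<Longrightarrow> B \<subseteq> A \<Longrightarrow> B \<noteq> {} \<Longrightarrow> step B"
  by (auto simp: is_step_def)

lemma step_seq_simps [simp]:
  "step_seq []"
  "step_seq (A # w) \<longleftrightarrow> step A \<and> step_seq w"
  "step_seq (w @ u) \<longleftrightarrow> step_seq w \<and> step_seq u"
  by (auto simp: is_step_seq_def)

lemma proj_simps [simp]:
  "proj sim ser a b [] = []"
  "proj sim ser a b (A # w) = proj_step sim ser a b A @ proj sim ser a b w"
  "proj sim ser a b (w @ u) = proj sim ser a b w @ proj sim ser a b u"
  by (simp_all add: proj_def)

lemma same_proj_sym: "same_proj w u \<Longrightarrow> same_proj u w"
  by (simp add: split_beta)

lemma same_proj_trans: "same_proj w u \<Longrightarrow> same_proj u v \<Longrightarrow> same_proj w v"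
  by (simp add: split_beta)

section \<open>Equivalence is compatible with left contexts\<close>

lemma equiv_refl [simp]: "w \<approx> w"
  by (simp add: comtrace_equiv_def)

lemma equiv_sym: "w \<approx> u \<Longrightarrow> u \<approx> w"
  unfolding comtrace_equiv_def by (rule equivclp_sym)

lemma equiv_trans [trans]: "w \<approx> u \<Longrightarrow> u \<approx> v \<Longrightarrow> w \<approx> v"
  unfolding comtrace_equiv_def by (rule equivclp_trans)

lemma equiv_join:
  assumes "step_seq z" "step A" "step B" "A \<times> B \<subseteq> ser"
  shows "A # B # z \<approx> (A \<union> B) # z"
proof -
  have "comtrace_rewr \<Sigma> sim ser (A # B # z) ((A \<union> B) # z)"
    unfolding comtrace_rewr_def
    by (rule exI[of _ "[]"], rule exI[of _ z], rule exI[of _ A], rule exI[of _ B]) (use assms in simp)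
  then show ?thesis
    unfolding comtrace_equiv_def by (rule r_into_equivclp)
qed

lemma rewr_append:
  assumes "step_seq x" "comtrace_rewr \<Sigma> sim ser w v"
  shows "comtrace_rewr \<Sigma> sim ser (x @ w) (x @ v)"
proof -
  from assms(2) obtain y z A B where
    "step_seq y" "step_seq z" "step A" "step B" "A \<times> B \<subseteq> ser"
    "w = y @ [A, B] @ z" "v = y @ [A \<union> B] @ z"
    unfolding comtrace_rewr_def by blast
  with assms(1) show ?thesis
    unfolding comtrace_rewr_def
    by (intro exI[of _ "x @ y"] exI[of _ z] exI[of _ A] exI[of _ B]) simp
qed

lemma equiv_append:
  assumes "step_seq x" "w \<approx> v"
  shows "x @ w \<approx> x @ v"
  using assms(2) unfolding comtrace_equiv_def
proof (induction rule: equivclp_induct)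
  case (step y z)
  then have "equivclp (comtrace_rewr \<Sigma> sim ser) (x @ y) (x @ z)"
    using rewr_append[OF assms(1)] by (blast intro: r_into_equivclp equivclp_sym)
  with step.IH show ?case
    by (blast intro: equivclp_trans)
qed simp

lemma equiv_Cons: "step A \<Longrightarrow> w \<approx> v \<Longrightarrow> A # w \<approx> A # v"
  using equiv_append[of "[A]"] by simp

section \<open>Invariance of projections\<close>

text \<open>Irreflexivity of \<open>ser\<close> makes \<open>A\<close> and \<open>B\<close>
  disjoint. In the critical case \<open>a\<close> is in \<open>A\<close> and \<open>b\<close> in
  \<open>B\<close>: then \<open>(a, b)\<close> is in \<open>ser\<close> but not in
  \<open>ind ser\<close>, so \<open>(b, a)\<close> is in \<open>wdp ser\<close> and the union
  projects to \<open>a\<close> followed by \<open>b\<close>. The mirrored case is the same.\<close>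

lemma proj_step_Un:
  assumes "A \<times> B \<subseteq> ser" "(a, b) \<notin> ind ser"
  shows "proj_step sim ser a b (A \<union> B) = proj_step sim ser a b A @ proj_step sim ser a b B"
proof -
  have "x \<in> A \<Longrightarrow> y \<in> B \<Longrightarrow> (x, y) \<in> ser \<and> x \<noteq> y" for x y
    using assms(1) ser_irrefl by blast
  from this[of a b] this[of b a] this[of a a] this[of b b] assms(2) show ?thesis
    unfolding proj_step_def ind_def wdp_def by auto
qed

lemma rewr_same_proj:
  assumes "comtrace_rewr \<Sigma> sim ser w v"
  shows "same_proj w v"
  using assms unfolding comtrace_rewr_def by (auto simp: proj_step_Un)

lemma equiv_same_proj: "w \<approx> u \<Longrightarrow> same_proj w u"
  unfolding comtrace_equiv_def
proof (induction rule: equivclp_induct)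
  case (step y z)
  \<comment> \<open>A link in \<open>equivclp\<close> may be a rewriting in either
    direction.\<close>
  from step.hyps(2) have "same_proj y z"
    using rewr_same_proj[of y z] same_proj_sym[OF rewr_same_proj[of z y]] by blast
  with step.IH show ?case
    by (rule same_proj_trans)
qed simp

lemma proj_eq_Nil:
  assumes "\<And>A. A \<in> set w \<Longrightarrow> a \<notin> A \<and> b \<notin> A"
  shows "proj sim ser a b w = []"
  using assms by (auto simp: proj_def proj_step_def)

text \<open>Diagonal pairs are never in \<open>ind ser\<close>, so equal projections include these
  tests for occurrence.\<close>

lemma proj_self_eq_Nil_iff: "proj sim ser a a w = [] \<longleftrightarrow> (\<forall>A \<in> set w. a \<notin> A)"
  by (auto simp: proj_def proj_step_def)

section \<open>Splitting steps and moving independent ones\<close>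

text \<open>The case distinction avoids the empty set, which is not a step.\<close>

definition rest :: "'a set \<Rightarrow> 'a set \<Rightarrow> 'a set list" where
  "rest E C = (if E \<subseteq> C then [] else [E - C])"

lemma step_seq_rest: "step E \<Longrightarrow> step_seq (rest E C)"
  by (auto simp: rest_def intro: step_subset)

lemma equiv_split:
  assumes "step E" "C \<subseteq> E" "C \<noteq> {}" "C \<times> (E - C) \<subseteq> ser" "step_seq z"
  shows "E # z \<approx> C # rest E C @ z"
proof (cases "E \<subseteq> C")
  case True
  with assms(2) show ?thesis
    by (simp add: rest_def)
next
  case False
  then have "C # (E - C) # z \<approx> (C \<union> (E - C)) # z"
    using assms by (intro equiv_join) (auto intro: step_subset)
  moreover have "C \<union> (E - C) = E"
    using assms(2) by blast
  ultimately show ?thesis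
    using False by (simp add: rest_def equiv_sym)
qed

text \<open>Independence gives \<open>ser\<close> in both orders, so \<open>C\<close> passes each
  step of \<open>x\<close> by merging with it and splitting off again on the other side.\<close>

lemma equiv_move_left:
  assumes "step_seq x" "step C" "step_seq z"
    and "\<And>A. A \<in> set x \<Longrightarrow> A \<times> C \<subseteq> ind ser"
  shows "x @ C # z \<approx> C # x @ z"
  using assms(1,4)
proof (induction x)
  case (Cons A x)
  then have A: "step A" "step_seq (x @ z)" "A \<times> C \<subseteq> ser" "C \<times> A \<subseteq> ser"
    using assms(3) by (auto simp: ind_def)
  have "A # x @ C # z \<approx> A # C # x @ z"
    using Cons A(1) by (intro equiv_Cons) auto
  also have "A # C # x @ z \<approx> (A \<union> C) # x @ z"
    using A assms(2) by (intro equiv_join)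
  also have "(A \<union> C) # x @ z \<approx> C # A # x @ z"
    using equiv_join[OF A(2) assms(2) A(1,4)] by (simp add: equiv_sym Un_commute)
  finally show ?case
    by simp
qed simp

section \<open>First letters of projections\<close>

text \<open>As \<open>c\<close> is in \<open>A\<close>, the letter \<open>y\<close> can come first
  only if \<open>A\<close> projects to \<open>y\<close> followed by \<open>c\<close>, that is, if
  \<open>y\<close> is in \<open>A\<close> and \<open>(c, y)\<close> is in
  \<open>wdp ser\<close>.\<close>

lemma proj_hd_other:
  assumes "step A" "(c, y) \<notin> ind ser" "c \<in> A" "y \<noteq> c"
    and "proj sim ser c y (A # w) = Some y # p"
  shows "y \<in> A \<and> (c, y) \<notin> ser"
  using assms pair_in_step_cases[OF assms(1,3), of y ser]
  by (auto simp: proj_step_def wdp_def ssm_def ind_def split: if_splits)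

text \<open>With both events in \<open>A\<close>, a leading \<open>c\<close> means
  \<open>(y, c)\<close> is in \<open>wdp ser\<close>, which outside \<open>ind ser\<close> amounts
  to \<open>(c, y)\<close> in \<open>ser\<close>. So the first letter tells whether \<open>y\<close>
  prevents \<open>c\<close> from being split off to the left.\<close>

lemma proj_hd_self_iff:
  assumes "step A" "(c, y) \<notin> ind ser" "c \<in> A" "y \<noteq> c"
  shows "(\<exists>p. proj sim ser c y (A # w) = Some c # p) \<longleftrightarrow> \<not> (y \<in> A \<and> (c, y) \<notin> ser)"
  using assms pair_in_step_cases[OF assms(1,3), of y ser]
  by (auto simp: proj_step_def wdp_def ssm_def ind_def)

section \<open>Extracting a minimal left part\<close>

lemma minimal_splittable:
  assumes "finite A" "A \<noteq> {}"
  obtains C where "C \<subseteq> A" "C \<noteq> {}" "C \<times> (A - C) \<subseteq> ser"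
    and "\<And>D. D \<subseteq> C \<Longrightarrow> D \<noteq> {} \<Longrightarrow> D \<times> (A - D) \<subseteq> ser \<Longrightarrow> D = C"
proof -
  let ?S = "{C. C \<subseteq> A \<and> C \<noteq> {} \<and> C \<times> (A - C) \<subseteq> ser}"
  have "finite ?S" "A \<in> ?S"
    using assms by auto
  then obtain C where "C \<in> ?S" "\<forall>D \<in> ?S. D \<subseteq> C \<longrightarrow> C = D"
    using finite_has_minimal[of ?S] by (metis (no_types, lifting) empty_iff)
  then show ?thesis
    by (intro that[of C]) auto
qed

lemma equiv_extract:
  assumes A: "step A" and u: "step_seq u" and eq: "same_proj (A # w) u"
    and C: "C \<subseteq> A" "C \<noteq> {}" "C \<times> (A - C) \<subseteq> ser"
    and minimal: "\<And>D. D \<subseteq> C \<Longrightarrow> D \<noteq> {} \<Longrightarrow> D \<times> (A - D) \<subseteq> ser \<Longrightarrow> D = C"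
  shows "\<exists>v. step_seq v \<and> u \<approx> C # v"
proof -
  have eq': "proj sim ser a b (A # w) = proj sim ser a b u"
    if "a \<in> \<Sigma>" "b \<in> \<Sigma>" "(a, b) \<notin> ind ser" for a b
    using eq that by blast
  have AS: "A \<subseteq> \<Sigma>"
    using A by (simp add: is_step_def)
  have "\<exists>E \<in> set u. E \<inter> C \<noteq> {}"
  proof -
    obtain c where "c \<in> C"
      using C(2) by blast
    moreover from this have "c \<in> A"
      using C(1) by blast
    moreover from this have "proj sim ser c c (A # w) = proj sim ser c c u"
      using AS ser_irrefl by (intro eq') (auto simp: ind_def)
    ultimately have "proj sim ser c c u \<noteq> []"
      by (auto simp: proj_step_def)
    with \<open>c \<in> C\<close> show ?thesis
      by (auto simp: proj_self_eq_Nil_iff)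
  qed
  then obtain x E z where split: "u = x @ E # z" "E \<inter> C \<noteq> {}"
    and before: "\<forall>F \<in> set x. F \<inter> C = {}"
    using split_list_first_prop[of u "\<lambda>E. E \<inter> C \<noteq> {}"] by auto
  have xEz: "step_seq x" "step E" "step_seq z"
    using u split(1) by auto
  \<comment> \<open>By minimality it suffices that \<open>E \<inter> C\<close> can itself be split
    off from \<open>A\<close>.\<close>
  have "C \<subseteq> E"
  proof -
    have "y \<in> E" if c: "c \<in> E \<inter> C" and y: "y \<in> A" "(c, y) \<notin> ser" for c y
    proof (rule ccontr)
      \<comment> \<open>Such a \<open>y\<close> lies in \<open>C\<close>, hence not in
        \<open>x\<close>; if it also misses \<open>E\<close>, the projection of \<open>u\<close>
        starts with \<open>c\<close>, which is impossible for \<open>A # w\<close>.\<close>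
      assume nE: "y \<notin> E"
      then have "y \<noteq> c" "y \<in> C"
        using c y C(3) by auto
      then have "proj sim ser c y u = Some c # proj sim ser c y z"
        using c nE before proj_eq_Nil[of x c y] split(1) by (auto simp: proj_step_def)
      moreover have nind: "(c, y) \<notin> ind ser"
        using y(2) by (simp add: ind_def)
      moreover have "proj sim ser c y (A # w) = proj sim ser c y u"
        using c y C(1) AS nind by (intro eq') auto
      ultimately show False
        using proj_hd_self_iff[OF A nind _ \<open>y \<noteq> c\<close>, of w] c y C(1) by auto
    qed
    then have "E \<inter> C = C"
      using split(2) C(3) by (intro minimal) blast+
    then show ?thesis
      by blast
  qed
  \<comment> \<open>A dependent \<open>y\<close> in \<open>x\<close> would come before
    \<open>c\<close> in the projection of \<open>u\<close>, hence also in that of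
    \<open>A # w\<close>. This puts \<open>y\<close> into \<open>C\<close>, against the choice of
    \<open>E\<close> as the first step meeting \<open>C\<close>.\<close>
  have indep: "(y, c) \<in> ind ser" if F: "F \<in> set x" "y \<in> F" and c: "c \<in> C" for F y c
  proof (rule ccontr)
    assume "(y, c) \<notin> ind ser"
    then have nind: "(c, y) \<notin> ind ser"
      by (auto simp: ind_def)
    have cx: "\<forall>F \<in> set x. c \<notin> F"
      using before c by blast
    have "y \<in> \<Sigma>"
      using xEz(1) F by (auto simp: is_step_seq_def is_step_def)
    obtain x1 F' x2 where x': "x = x1 @ F' # x2" "y \<in> F'" "\<forall>G \<in> set x1. y \<notin> G"
      using split_list_first_prop[of x "\<lambda>F. y \<in> F"] F by auto
    then have "proj sim ser c y u = Some y # proj sim ser c y (x2 @ E # z)"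
      using cx split(1) proj_eq_Nil[of x1 c y] by (simp add: proj_step_def)
    moreover have "proj sim ser c y (A # w) = proj sim ser c y u"
      using c C(1) AS nind \<open>y \<in> \<Sigma>\<close> by (intro eq') auto
    moreover have "y \<noteq> c"
      using cx F by blast
    ultimately have "y \<in> A \<and> (c, y) \<notin> ser"
      using proj_hd_other[of A c y w] A c C(1) nind by auto
    then have "y \<in> C"
      using c C(3) by blast
    then show False
      using before F by blast
  qed
  have ser: "(c, y) \<in> ser" if c: "c \<in> C" and y: "y \<in> E - C" for c y
  proof (cases "\<exists>F \<in> set x. y \<in> F")
    case True
    then show ?thesis
      using indep c by (auto simp: ind_def)
  next
    \<comment> \<open>Now the projection of \<open>u\<close> starts at \<open>E\<close>, so the
      first letters for \<open>E\<close> and \<open>A\<close> can be compared: a \<open>y\<close>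
      that blocks \<open>c\<close> in \<open>E\<close> also blocks it in \<open>A\<close>.\<close>
    case False
    show ?thesis
    proof (rule ccontr)
      assume nser: "(c, y) \<notin> ser"
      then have nind: "(c, y) \<notin> ind ser"
        by (auto simp: ind_def)
      have "y \<noteq> c" "y \<in> \<Sigma>" "c \<in> E" "c \<in> A"
        using c y xEz(2) C(1) \<open>C \<subseteq> E\<close> by (auto simp: is_step_def)
      have "proj sim ser c y x = []"
        using False before c by (intro proj_eq_Nil) blast
      then have "proj sim ser c y (A # w) = proj sim ser c y (E # z)"
        using eq'[of c y] nind \<open>c \<in> A\<close> \<open>y \<in> \<Sigma>\<close> AS split(1) by auto
      then have "y \<in> A"
        using proj_hd_self_iff[OF A nind \<open>c \<in> A\<close> \<open>y \<noteq> c\<close>, of w]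
          proj_hd_self_iff[OF xEz(2) nind \<open>c \<in> E\<close> \<open>y \<noteq> c\<close>, of z] y nser by auto
      then show False
        using c y nser C(3) by blast
    qed
  qed
  have stepC: "step C"
    using step_subset[OF A C(1,2)] .
  have "u \<approx> x @ C # rest E C @ z"
    unfolding split(1) using xEz C(2) \<open>C \<subseteq> E\<close> ser
    by (intro equiv_append equiv_split) auto
  also have "x @ C # rest E C @ z \<approx> C # x @ rest E C @ z"
    using xEz stepC indep by (intro equiv_move_left) (auto simp: step_seq_rest)
  finally show ?thesis
    using xEz step_seq_rest by (intro exI[of _ "x @ rest E C @ z"]) simp
qed

section \<open>Induction on the number of events\<close>

lemma same_proj_equiv:
  assumes "step_seq w" "step_seq u" "same_proj w u"
  shows "w \<approx> u"
  using assms
proof (induction "sum_list (map card w)" arbitrary: w u rule: less_induct)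
  case less
  show ?case
  proof (cases w)
    case Nil
    \<comment> \<open>Any event of \<open>u\<close> would show in its diagonal projection.\<close>
    have "u = []"
    proof (cases u)
      case (Cons B u')
      then obtain b where b: "b \<in> B" "b \<in> \<Sigma>"
        using less.prems(2) by (auto simp: is_step_def)
      then have "proj sim ser b b w = proj sim ser b b u"
        using less.prems(3) ser_irrefl by (auto simp: ind_def)
      then show ?thesis
        using Nil Cons b by (simp add: proj_step_def)
    qed
    with Nil show ?thesis
      by simp
  next
    case (Cons A w')
    have A: "step A" and w': "step_seq w'"
      using less.prems(1) Cons by auto
    have fin: "finite A"
      using step_finite[OF A] .
    obtain C where C: "C \<subseteq> A" "C \<noteq> {}" "C \<times> (A - C) \<subseteq> ser"
      and min: "\<And>D. D \<subseteq> C \<Longrightarrow> D \<noteq> {} \<Longrightarrow> D \<times> (A - D) \<subseteq> ser \<Longrightarrow> D = C"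
      using minimal_splittable[OF fin] A unfolding is_step_def by blast
    obtain v where v: "step_seq v" "u \<approx> C # v"
      using equiv_extract[OF A less.prems(2) _ C min] less.prems(3) Cons by blast
    have w: "w \<approx> C # rest A C @ w'"
      unfolding Cons using A C w' by (intro equiv_split)
    have "same_proj (C # rest A C @ w') (C # v)"
      using same_proj_trans[OF same_proj_sym[OF equiv_same_proj[OF w]]
          same_proj_trans[OF less.prems(3) equiv_same_proj[OF v(2)]]] .
    \<comment> \<open>Both projections begin with that of \<open>C\<close>, which cancels.\<close>
    then have "same_proj (rest A C @ w') v"
      by simp
    moreover have "sum_list (map card (rest A C @ w')) < sum_list (map card w)"
    proof -
      \<comment> \<open>The measure drops because \<open>C\<close> is nonempty.\<close>
      have "A - C \<subset> A"
        using C(1,2) by blast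
      then have "card (A - C) < card A"
        using fin by (intro psubset_card_mono)
      then show ?thesis
        by (simp add: rest_def Cons)
    qed
    ultimately have "rest A C @ w' \<approx> v"
      using less.hyps v(1) w' step_seq_rest[OF A] by simp
    then have "C # rest A C @ w' \<approx> C # v"
      using step_subset[OF A C(1,2)] by (intro equiv_Cons)
    with w v(2) show ?thesis
      by (blast intro: equiv_trans equiv_sym)
  qed
qed

end

theorem theorem4p1:
  fixes \<Sigma> :: "'a set" and sim ser :: "('a \<times> 'a) set" and w u :: "'a set list"
  assumes "comtrace_alphabet \<Sigma> sim ser"
    and "is_step_seq \<Sigma> sim w" and "is_step_seq \<Sigma> sim u"
  shows "comtrace_equiv \<Sigma> sim ser w u \<longleftrightarrow>
    (\<forall>(a, b) \<in> (\<Sigma> \<times> \<Sigma>) - ind ser. proj sim ser a b w = proj sim ser a b u)"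
proof -
  interpret comtrace \<Sigma> sim ser
    using assms(1) by unfold_locales
  show ?thesis
    using equiv_same_proj same_proj_equiv assms(2,3) by blast
qed

end
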